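(* For all sufficiently large $n$, the proportion of quasigroups among magmas with $n$ elements is less than $n/n!$. That is, there is $N$ such that for all $n\ge N$, the number of binary operations on $\{1,\dots,n\}$ that are quasigroup operations, divided by the number of all binary operations on $\{1,\dots,n\}$, is less than $n/n!$.
   Context: A magma is a set with a binary operation. A finite quasigroup is a magma whose Cayley table is a Latin square, i.e. every element occurs exactly once in each row and each column of the table. Magmas with $n$ elements are counted as binary operations on the fixed set $\{1,\dots,n\}$ (equivalently, as Cayley tables). *)

theory Defs
  imports Complex_Main "HOL-Library.FuncSet"
begin

(* Operations are curried. They are taken extensional in both arguments, so that two of them
   are equal iff their Cayley tables agree on A and counting them counts Cayley tables. *)
definition magma_ops :: "'a set \<Rightarrow> ('a \<Rightarrow> 'a \<Rightarrow> 'a) set" where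
  "magma_ops A = A \<rightarrow>\<^sub>E (A \<rightarrow>\<^sub>E A)"

(* The entry in row x and column y of the Cayley table is f x y. *)
definition latin_square :: "'a set \<Rightarrow> ('a \<Rightarrow> 'a \<Rightarrow> 'a) \<Rightarrow> bool" where
  "latin_square A f \<longleftrightarrow>
     (\<forall>x\<in>A. \<forall>z\<in>A. \<exists>!y. y \<in> A \<and> f x y = z) \<and>
     (\<forall>y\<in>A. \<forall>z\<in>A. \<exists>!x. x \<in> A \<and> f x y = z)"

definition quasigroup_ops :: "'a set \<Rightarrow> ('a \<Rightarrow> 'a \<Rightarrow> 'a) set" where
  "quasigroup_ops A = {f \<in> magma_ops A. latin_square A f}"

end

theory Submission
  imports Defs
begin

text \<open>
  Every row of a Latin square is a permutation, so there are at most \<open>(n!)\<^sup>n\<close> quasigroups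
  among the \<open>n\<close> to the power \<open>n\<^sup>2\<close> magmas; the bound \<open>n! \<le> n\<^bsup>n-1\<^esup>\<close> suffices to compare
  this ratio with \<open>n / n!\<close>.
\<close>

text \<open>Row \<open>x\<close> hits every element of \<open>A\<close>, and a finite
  \<open>A\<close> leaves no room for a repeated value. Uniqueness would not exclude repeated values
  outside \<open>A\<close>.\<close>

lemma latin_square_row_inj_on:
  assumes "finite A" "latin_square A f" "x \<in> A"
  shows "inj_on (f x) A"
proof -
  have "A \<subseteq> f x ` A"
    using assms(2,3) unfolding latin_square_def by blast
  with assms(1) show ?thesis
    by (simp add: card_mono card_image_le eq_card_imp_inj_on le_antisym)
qed

lemma card_quasigroup_ops_le:
  assumes "finite A"
  shows "card (quasigroup_ops A) \<le> fact (card A) ^ card A"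
proof -
  let ?P = "{g \<in> A \<rightarrow>\<^sub>E A. inj_on g A}"
  have "quasigroup_ops A \<subseteq> A \<rightarrow>\<^sub>E ?P"
    using latin_square_row_inj_on[OF assms]
    by (auto simp: quasigroup_ops_def magma_ops_def PiE_iff extensional_def)
  moreover have "finite (A \<rightarrow>\<^sub>E ?P)"
    using assms by (simp add: finite_PiE)
  ultimately have "card (quasigroup_ops A) \<le> card (A \<rightarrow>\<^sub>E ?P)"
    by (intro card_mono)
  \<comment> \<open>The injective self-maps are counted by a falling product, which
    \<open>fact_prod_rev\<close> turns into a factorial.\<close>
  also have "\<dots> = fact (card A) ^ card A"
    using assms by (simp add: card_PiE card_inj_on_subset_funcset fact_prod_rev)
  finally show ?thesis .
qed

lemma card_magma_ops:
  assumes "finite A"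
  shows "card (magma_ops A) = card A ^ (card A * card A)"
  using assms by (simp add: magma_ops_def card_PiE power_mult)

text \<open>Apart from 1, the factorial has \<open>m\<close> factors, each at most
  \<open>Suc m\<close>.\<close>

lemma fact_Suc_le_power: "fact (Suc m) \<le> Suc m ^ m"
proof (induction m)
  case (Suc m)
  have "fact (Suc (Suc m)) = Suc (Suc m) * fact (Suc m)"
    by (simp only: fact_Suc of_nat_id)
  also have "\<dots> \<le> Suc (Suc m) * Suc (Suc m) ^ m"
    by (intro mult_left_mono order_trans[OF Suc.IH] power_mono) auto
  finally show ?case by (simp only: power_Suc)
qed simp

text \<open>The target inequality with denominators cleared and the quasigroup count replaced by its
  upper bound.\<close>

lemma fact_power_Suc_less:
  fixes n :: nat
  assumes "n \<ge> 2"
  shows "fact n ^ Suc n < n * n ^ (n * n)"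
proof -
  obtain m where m: "n = Suc m"
    using assms by (cases n) auto
  have "fact n ^ Suc n \<le> (n ^ m) ^ Suc n"
    using fact_Suc_le_power[of m] by (intro power_mono) (simp_all only: m zero_le)
  also have "\<dots> = n ^ (m * Suc n)"
    by (simp only: power_mult)
  \<comment> \<open>The left exponent is m(m + 2) = n^2 - 1.\<close>
  also have "\<dots> < n ^ Suc (n * n)"
    using assms by (intro power_strict_increasing) (auto simp: m)
  finally show ?thesis by simp
qed

theorem theorem1p3:
  shows "\<exists>N::nat. \<forall>n\<ge>N. real (card (quasigroup_ops {1..n})) / real (card (magma_ops {1..n})) < real n / fact n"
\<comment> \<open>The threshold 2 is optimal: at n = 1 both sides equal 1.\<close>
proof (intro exI[of _ 2] allI impI)
  fix n :: nat
  assume n: "n \<ge> 2"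
  have "card (quasigroup_ops {1..n}) * fact n \<le> fact n ^ Suc n"
    using card_quasigroup_ops_le[of "{1..n}"] by simp
  also have "\<dots> < n * card (magma_ops {1..n})"
    using fact_power_Suc_less[OF n] by (simp add: card_magma_ops)
  finally have "real (card (quasigroup_ops {1..n}) * fact n) < real (n * card (magma_ops {1..n}))"
    by (simp only: of_nat_less_iff)
  moreover have "card (magma_ops {1..n}) > 0"
    using n by (simp add: card_magma_ops)
  ultimately show "real (card (quasigroup_ops {1..n})) / real (card (magma_ops {1..n})) < real n / fact n"
    by (simp add: field_simps)
qed

end
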